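(* Let $G$ be a finite group and $\sigma,\tau\in\operatorname{End}(G)$ group endomorphisms. Then every $(\sigma,\tau)$-derivation of $\mathbb{C}[G]$ is inner.
   Context: The endomorphisms $\sigma,\tau$ are extended linearly to $\mathbb{C}[G]$. A $(\sigma,\tau)$-derivation is a $\mathbb{C}$-linear map $D:\mathbb{C}[G]\to\mathbb{C}[G]$ with $D(ab)=D(a)\tau(b)+\sigma(a)D(b)$ for all $a,b$. It is inner if there is $p\in\mathbb{C}[G]$ with $D(x)=p\tau(x)-\sigma(x)p$ for all $x$. *)

theory Defs
  imports Complex_Main "HOL-Algebra.Module" "HOL-Library.Poly_Mapping"
begin

text \<open>
  Elements of the group algebra \<open>\<complex>[G]\<close> are finitely supported functions from the carrier of \<open>G\<close> to
  \<open>\<complex>\<close>, as in the library's free Abelian groups.  The field \<open>smult\<close> of the record provides the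
  action of the complex scalars.
\<close>

definition group_algebra :: "('a, 'm) monoid_scheme \<Rightarrow> (complex, 'a \<Rightarrow>\<^sub>0 complex) module" where
  "group_algebra G = \<lparr>
     carrier = {a. Poly_Mapping.keys a \<subseteq> carrier G},
     monoid.mult = (\<lambda>a b. \<Sum>x\<in>Poly_Mapping.keys a. \<Sum>y\<in>Poly_Mapping.keys b.
       Poly_Mapping.single (x \<otimes>\<^bsub>G\<^esub> y) (Poly_Mapping.lookup a x * Poly_Mapping.lookup b y)),
     one = Poly_Mapping.single \<one>\<^bsub>G\<^esub> 1,
     zero = 0,
     add = (+),
     smult = (\<lambda>c. Poly_Mapping.map ((*) c))\<rparr>"

definition linear_extension :: "('a \<Rightarrow> 'b) \<Rightarrow> ('a \<Rightarrow>\<^sub>0 complex) \<Rightarrow> ('b \<Rightarrow>\<^sub>0 complex)" where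
  "linear_extension f a =
     (\<Sum>x\<in>Poly_Mapping.keys a. Poly_Mapping.single (f x) (Poly_Mapping.lookup a x))"

definition linear_endomorphism ::
    "('a, 'm) monoid_scheme \<Rightarrow> (('a \<Rightarrow>\<^sub>0 complex) \<Rightarrow> ('a \<Rightarrow>\<^sub>0 complex)) \<Rightarrow> bool" where
  "linear_endomorphism G D \<longleftrightarrow>
     (let A = group_algebra G in
       D \<in> carrier A \<rightarrow> carrier A \<and>
       (\<forall>a\<in>carrier A. \<forall>b\<in>carrier A. D (a \<oplus>\<^bsub>A\<^esub> b) = D a \<oplus>\<^bsub>A\<^esub> D b) \<and>
       (\<forall>c. \<forall>a\<in>carrier A. D (c \<odot>\<^bsub>A\<^esub> a) = c \<odot>\<^bsub>A\<^esub> D a))"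

definition twisted_derivation ::
    "('a, 'm) monoid_scheme \<Rightarrow> ('a \<Rightarrow> 'a) \<Rightarrow> ('a \<Rightarrow> 'a) \<Rightarrow>
      (('a \<Rightarrow>\<^sub>0 complex) \<Rightarrow> ('a \<Rightarrow>\<^sub>0 complex)) \<Rightarrow> bool" where
  "twisted_derivation G \<sigma> \<tau> D \<longleftrightarrow>
     linear_endomorphism G D \<and>
     (let A = group_algebra G in
       \<forall>a\<in>carrier A. \<forall>b\<in>carrier A.
         D (a \<otimes>\<^bsub>A\<^esub> b) =
           D a \<otimes>\<^bsub>A\<^esub> linear_extension \<tau> b \<oplus>\<^bsub>A\<^esub> linear_extension \<sigma> a \<otimes>\<^bsub>A\<^esub> D b)"

definition inner_twisted_derivation ::
    "('a, 'm) monoid_scheme \<Rightarrow> ('a \<Rightarrow> 'a) \<Rightarrow> ('a \<Rightarrow> 'a) \<Rightarrow>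
      (('a \<Rightarrow>\<^sub>0 complex) \<Rightarrow> ('a \<Rightarrow>\<^sub>0 complex)) \<Rightarrow> bool" where
  "inner_twisted_derivation G \<sigma> \<tau> D \<longleftrightarrow>
     (let A = group_algebra G in
       \<exists>p\<in>carrier A. \<forall>x\<in>carrier A.
         D x = p \<otimes>\<^bsub>A\<^esub> linear_extension \<tau> x \<ominus>\<^bsub>A\<^esub> linear_extension \<sigma> x \<otimes>\<^bsub>A\<^esub> p)"

end

theory Submission
  imports Defs
begin

text \<open>
  The proof averages over the group.  For a twisted derivation \<open>D\<close> put
  \<open>q = (\<Sum>g. D g \<cdot> \<tau> (g\<inverse>))\<close>, where a group element stands for its basis vector.  The product rule gives
  \<open>\<sigma> a \<cdot> D g = D (a g) - D a \<cdot> \<tau> g\<close>; multiplying by \<open>\<tau> (g\<inverse>)\<close> on the right and summing over the \<open>n\<close>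
  elements of the group yields
  \<open>\<sigma> a \<cdot> q = (\<Sum>g. D (a g) \<cdot> \<tau> (g\<inverse>)) - n \<cdot> D a\<close>.
  The remaining sum is \<open>q \<cdot> \<tau> a\<close>: by linearity \<open>a\<close> may be taken to be a group element, and then
  \<open>h = a g\<close> runs over the group together with \<open>g\<close>, while \<open>\<tau> (g\<inverse>) = \<tau> (h\<inverse>) \<cdot> \<tau> a\<close>
  (lemma \<open>averaged_sum_translate\<close>).  Hence \<open>n \<cdot> D a = q \<cdot> \<tau> a - \<sigma> a \<cdot> q\<close>.  Since \<open>n\<close> is invertible in
  \<open>\<complex>\<close>, the element \<open>p = q / n\<close> shows that \<open>D\<close> is inner.

  Identities in the algebra are checked on basis vectors and extended by additivity
  (lemma \<open>group_algebra_induct\<close>).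
\<close>

section \<open>The group algebra as an associative algebra\<close>

lemma carrier_group_algebra:
  "a \<in> carrier (group_algebra G) \<longleftrightarrow> Poly_Mapping.keys a \<subseteq> carrier G"
  by (simp add: group_algebra_def)

lemma add_group_algebra [simp]: "a \<oplus>\<^bsub>group_algebra G\<^esub> b = a + b"
  by (simp add: group_algebra_def)

lemma zero_group_algebra [simp]: "\<zero>\<^bsub>group_algebra G\<^esub> = 0"
  by (simp add: group_algebra_def)

lemma group_algebra_zero_closed: "0 \<in> carrier (group_algebra G)"
  by (simp add: carrier_group_algebra)

lemma group_algebra_single_closed:
  "x \<in> carrier G \<Longrightarrow> Poly_Mapping.single x c \<in> carrier (group_algebra G)"
  by (simp add: carrier_group_algebra)

lemma group_algebra_add_closed:
  "\<lbrakk>a \<in> carrier (group_algebra G); b \<in> carrier (group_algebra G)\<rbrakk>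
    \<Longrightarrow> a + b \<in> carrier (group_algebra G)"
  using keys_add[of a b] by (auto simp: carrier_group_algebra)

lemma group_algebra_sum_closed:
  "(\<And>i. i \<in> I \<Longrightarrow> f i \<in> carrier (group_algebra G)) \<Longrightarrow> sum f I \<in> carrier (group_algebra G)"
  by (induction I rule: infinite_finite_induct)
    (auto intro: group_algebra_zero_closed group_algebra_add_closed)

lemma lookup_smult_group_algebra [simp]:
  "Poly_Mapping.lookup (c \<odot>\<^bsub>group_algebra G\<^esub> a) x = c * Poly_Mapping.lookup a x"
  by (simp add: group_algebra_def Poly_Mapping.map.rep_eq when_def)

lemma keys_smult_group_algebra:
  "Poly_Mapping.keys (c \<odot>\<^bsub>group_algebra G\<^esub> a) \<subseteq> Poly_Mapping.keys a"
  by (auto simp: in_keys_iff)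

lemma smult_single_group_algebra:
  "c \<odot>\<^bsub>group_algebra G\<^esub> Poly_Mapping.single x d = Poly_Mapping.single x (c * d)"
  by (rule poly_mapping_eqI) (simp add: lookup_single when_def)

lemma additive_smult_group_algebra: "additive (\<lambda>a. c \<odot>\<^bsub>group_algebra G\<^esub> a)"
  by (standard, rule poly_mapping_eqI) (simp add: lookup_add algebra_simps)

lemma minus_group_algebra:
  assumes "b \<in> carrier (group_algebra G)"
  shows "a \<ominus>\<^bsub>group_algebra G\<^esub> b = a - b"
proof -
  have "\<ominus>\<^bsub>group_algebra G\<^esub> b = - b"
    unfolding a_inv_def m_inv_def
  proof (rule the_equality)
    show "- b \<in> carrier (add_monoid (group_algebra G)) \<and>
        b \<otimes>\<^bsub>add_monoid (group_algebra G)\<^esub> - b = \<one>\<^bsub>add_monoid (group_algebra G)\<^esub> \<and>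
        - b \<otimes>\<^bsub>add_monoid (group_algebra G)\<^esub> b = \<one>\<^bsub>add_monoid (group_algebra G)\<^esub>"
      using assms by (simp add: carrier_group_algebra)
  next
    fix c
    assume "c \<in> carrier (add_monoid (group_algebra G)) \<and>
        b \<otimes>\<^bsub>add_monoid (group_algebra G)\<^esub> c = \<one>\<^bsub>add_monoid (group_algebra G)\<^esub> \<and>
        c \<otimes>\<^bsub>add_monoid (group_algebra G)\<^esub> b = \<one>\<^bsub>add_monoid (group_algebra G)\<^esub>"
    then show "c = - b"
      by (simp add: eq_neg_iff_add_eq_0)
  qed
  then show ?thesis
    by (simp add: a_minus_def)
qed

lemma sum_single_lookup: "(\<Sum>x\<in>Poly_Mapping.keys a. Poly_Mapping.single x (Poly_Mapping.lookup a x)) = a"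
  by (rule poly_mapping_eqI) (auto simp: lookup_sum lookup_single when_def in_keys_iff)

lemma group_algebra_induct [consumes 1, case_names zero single add]:
  assumes a: "a \<in> carrier (group_algebra G)"
    and zero: "P 0"
    and single: "\<And>x c. x \<in> carrier G \<Longrightarrow> P (Poly_Mapping.single x c)"
    and add: "\<And>a b. \<lbrakk>a \<in> carrier (group_algebra G); b \<in> carrier (group_algebra G); P a; P b\<rbrakk>
      \<Longrightarrow> P (a + b)"
  shows "P a"
proof -
  let ?s = "\<lambda>x. Poly_Mapping.single x (Poly_Mapping.lookup a x)"
  have "P (sum ?s S)" if "finite S" "S \<subseteq> carrier G" for S
    using that
  proof (induction S)
    case (insert x S)
    then show ?case
      by (auto intro!: add single group_algebra_single_closed group_algebra_sum_closed)
  qed (simp add: zero)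
  then have "P (sum ?s (Poly_Mapping.keys a))"
    using a by (simp add: carrier_group_algebra)
  then show ?thesis
    by (simp add: sum_single_lookup)
qed

text \<open>
  Enlarging the index sets beyond the supports only adds zero terms.  Additivity of the product is
  read off from this form, because summands with different supports can be expanded over one
  common index set.
\<close>

lemma mult_group_algebra_superset:
  assumes "finite S" "Poly_Mapping.keys a \<subseteq> S" "finite T" "Poly_Mapping.keys b \<subseteq> T"
  shows "a \<otimes>\<^bsub>group_algebra G\<^esub> b = (\<Sum>x\<in>S. \<Sum>y\<in>T.
    Poly_Mapping.single (x \<otimes>\<^bsub>G\<^esub> y) (Poly_Mapping.lookup a x * Poly_Mapping.lookup b y))"
proof -
  let ?f = "\<lambda>x y. Poly_Mapping.single (x \<otimes>\<^bsub>G\<^esub> y) (Poly_Mapping.lookup a x * Poly_Mapping.lookup b y)"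
  have "a \<otimes>\<^bsub>group_algebra G\<^esub> b = (\<Sum>x\<in>Poly_Mapping.keys a. \<Sum>y\<in>Poly_Mapping.keys b. ?f x y)"
    by (simp add: group_algebra_def)
  also have "\<dots> = (\<Sum>x\<in>Poly_Mapping.keys a. \<Sum>y\<in>T. ?f x y)"
    using assms by (intro sum.cong sum.mono_neutral_left) (auto simp: in_keys_iff)
  also have "\<dots> = (\<Sum>x\<in>S. \<Sum>y\<in>T. ?f x y)"
    using assms by (intro sum.mono_neutral_left) (auto simp: in_keys_iff)
  finally show ?thesis .
qed

lemma mult_single_group_algebra:
  "Poly_Mapping.single x c \<otimes>\<^bsub>group_algebra G\<^esub> Poly_Mapping.single y d =
    Poly_Mapping.single (x \<otimes>\<^bsub>G\<^esub> y) (c * d)"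
  by (subst mult_group_algebra_superset[of "{x}" _ "{y}"]) auto

lemma additive_mult_left:
  fixes b :: "'a \<Rightarrow>\<^sub>0 complex"
  shows "additive (\<lambda>a. a \<otimes>\<^bsub>group_algebra G\<^esub> b)"
proof
  fix a a' :: "'a \<Rightarrow>\<^sub>0 complex"
  let ?S = "Poly_Mapping.keys a \<union> Poly_Mapping.keys a'"
  note expand = mult_group_algebra_superset[of ?S _ "Poly_Mapping.keys b"]
  show "(a + a') \<otimes>\<^bsub>group_algebra G\<^esub> b =
      a \<otimes>\<^bsub>group_algebra G\<^esub> b + a' \<otimes>\<^bsub>group_algebra G\<^esub> b"
    by (simp add: expand keys_add lookup_add distrib_right single_add sum.distrib)
qed

lemma additive_mult_right:
  fixes a :: "'a \<Rightarrow>\<^sub>0 complex"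
  shows "additive (\<lambda>b. a \<otimes>\<^bsub>group_algebra G\<^esub> b)"
proof
  fix b b' :: "'a \<Rightarrow>\<^sub>0 complex"
  let ?T = "Poly_Mapping.keys b \<union> Poly_Mapping.keys b'"
  note expand = mult_group_algebra_superset[of "Poly_Mapping.keys a" _ ?T]
  show "a \<otimes>\<^bsub>group_algebra G\<^esub> (b + b') =
      a \<otimes>\<^bsub>group_algebra G\<^esub> b + a \<otimes>\<^bsub>group_algebra G\<^esub> b'"
    by (simp add: expand keys_add lookup_add distrib_left single_add sum.distrib)
qed

lemma smult_mult_left:
  "(c \<odot>\<^bsub>group_algebra G\<^esub> a) \<otimes>\<^bsub>group_algebra G\<^esub> b =
    c \<odot>\<^bsub>group_algebra G\<^esub> (a \<otimes>\<^bsub>group_algebra G\<^esub> b)"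
  by (simp add: mult_group_algebra_superset[of "Poly_Mapping.keys a" _ "Poly_Mapping.keys b"]
      keys_smult_group_algebra additive.sum[OF additive_smult_group_algebra]
      smult_single_group_algebra mult.assoc)

lemma smult_mult_right:
  "a \<otimes>\<^bsub>group_algebra G\<^esub> (c \<odot>\<^bsub>group_algebra G\<^esub> b) =
    c \<odot>\<^bsub>group_algebra G\<^esub> (a \<otimes>\<^bsub>group_algebra G\<^esub> b)"
  by (simp add: mult_group_algebra_superset[of "Poly_Mapping.keys a" _ "Poly_Mapping.keys b"]
      keys_smult_group_algebra additive.sum[OF additive_smult_group_algebra]
      smult_single_group_algebra mult.left_commute)

lemma group_algebra_smult_closed:
  "a \<in> carrier (group_algebra G) \<Longrightarrow> c \<odot>\<^bsub>group_algebra G\<^esub> a \<in> carrier (group_algebra G)"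
  using keys_smult_group_algebra[where c = c and a = a and G = G] by (auto simp: carrier_group_algebra)

context group
begin

lemma group_algebra_mult_closed:
  assumes "a \<in> carrier (group_algebra G)" "b \<in> carrier (group_algebra G)"
  shows "a \<otimes>\<^bsub>group_algebra G\<^esub> b \<in> carrier (group_algebra G)"
  unfolding mult_group_algebra_superset[OF finite_keys subset_refl finite_keys subset_refl]
  using assms
  by (intro group_algebra_sum_closed group_algebra_single_closed)
    (auto simp: carrier_group_algebra)

lemma group_algebra_mult_assoc:
  assumes a: "a \<in> carrier (group_algebra G)" and b: "b \<in> carrier (group_algebra G)"
    and c: "c \<in> carrier (group_algebra G)"
  shows "(a \<otimes>\<^bsub>group_algebra G\<^esub> b) \<otimes>\<^bsub>group_algebra G\<^esub> c =
    a \<otimes>\<^bsub>group_algebra G\<^esub> (b \<otimes>\<^bsub>group_algebra G\<^esub> c)"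
proof -
  note additivity = additive.zero[OF additive_mult_left] additive.zero[OF additive_mult_right]
    additive.add[OF additive_mult_left] additive.add[OF additive_mult_right]
  show ?thesis
    using a
  proof (induction a rule: group_algebra_induct)
    case (single x r)
    show ?case
      using b
    proof (induction b rule: group_algebra_induct)
      case (single y s)
      show ?case
        using c \<open>x \<in> carrier G\<close> \<open>y \<in> carrier G\<close>
        by (induction c rule: group_algebra_induct)
          (simp_all add: additivity mult_single_group_algebra m_assoc mult.assoc)
    qed (simp_all add: additivity)
  qed (simp_all add: additivity)
qed

lemma group_algebra_mult_one:
  assumes "a \<in> carrier (group_algebra G)"
  shows "a \<otimes>\<^bsub>group_algebra G\<^esub> Poly_Mapping.single \<one> 1 = a"
  using assms
  by (induction a rule: group_algebra_induct)
    (simp_all add: additive.zero[OF additive_mult_left] additive.add[OF additive_mult_left]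
      mult_single_group_algebra)

end

section \<open>Linear extensions\<close>

lemma linear_extension_superset:
  assumes "finite S" "Poly_Mapping.keys a \<subseteq> S"
  shows "linear_extension f a = (\<Sum>x\<in>S. Poly_Mapping.single (f x) (Poly_Mapping.lookup a x))"
  unfolding linear_extension_def using assms
  by (intro sum.mono_neutral_left) (auto simp: in_keys_iff)

lemma linear_extension_single:
  "linear_extension f (Poly_Mapping.single x c) = Poly_Mapping.single (f x) c"
  by (simp add: linear_extension_superset[of "{x}"])

lemma additive_linear_extension: "additive (linear_extension f)"
proof
  fix a b
  show "linear_extension f (a + b) = linear_extension f a + linear_extension f b"
    by (simp add: linear_extension_superset[of "Poly_Mapping.keys a \<union> Poly_Mapping.keys b"]
        keys_add lookup_add single_add sum.distrib)
qed

lemma linear_extension_closed: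
  assumes "f \<in> carrier G \<rightarrow> carrier H" "a \<in> carrier (group_algebra G)"
  shows "linear_extension f a \<in> carrier (group_algebra H)"
  unfolding linear_extension_def using assms
  by (intro group_algebra_sum_closed group_algebra_single_closed) (auto simp: carrier_group_algebra)

section \<open>Averaging over the group\<close>

text \<open>
  Both sides are additive in \<open>a\<close>, so let \<open>a = c x\<close> with \<open>x\<close> in the group.  Substituting
  \<open>h = x \<otimes> g\<close> in the sum on the left turns \<open>\<tau> (g\<inverse>)\<close> into \<open>\<tau> (h\<inverse>) \<cdot> \<tau> x\<close>, and the scalar \<open>c\<close> moves
  past \<open>D\<close> by linearity.
\<close>

lemma (in group) averaged_sum_translate:
  assumes D: "linear_endomorphism G D" and \<tau>: "\<tau> \<in> hom G G"
    and a: "a \<in> carrier (group_algebra G)"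
  shows "(\<Sum>g\<in>carrier G. D (a \<otimes>\<^bsub>group_algebra G\<^esub> Poly_Mapping.single g 1)
        \<otimes>\<^bsub>group_algebra G\<^esub> Poly_Mapping.single (\<tau> (inv g)) 1) =
    (\<Sum>g\<in>carrier G. D (Poly_Mapping.single g 1)
        \<otimes>\<^bsub>group_algebra G\<^esub> Poly_Mapping.single (\<tau> (inv g)) 1)
      \<otimes>\<^bsub>group_algebra G\<^esub> linear_extension \<tau> a"
    (is "?L a = ?q \<otimes>\<^bsub>group_algebra G\<^esub> _")
proof -
  have D_closed: "\<And>a. a \<in> carrier (group_algebra G) \<Longrightarrow> D a \<in> carrier (group_algebra G)"
    and D_add: "\<And>a b. \<lbrakk>a \<in> carrier (group_algebra G); b \<in> carrier (group_algebra G)\<rbrakk>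
      \<Longrightarrow> D (a + b) = D a + D b"
    and D_smult: "\<And>c a. a \<in> carrier (group_algebra G)
      \<Longrightarrow> D (c \<odot>\<^bsub>group_algebra G\<^esub> a) = c \<odot>\<^bsub>group_algebra G\<^esub> D a"
    using D by (auto simp: linear_endomorphism_def Let_def)
  have \<tau>_closed: "\<And>x. x \<in> carrier G \<Longrightarrow> \<tau> x \<in> carrier G"
    using \<tau> by (auto simp: hom_def)
  have D_zero: "D 0 = 0"
    using D_add[of 0 0] by (simp add: group_algebra_zero_closed)
  show ?thesis
    using a
  proof (induction a rule: group_algebra_induct)
    case zero
    show ?case
      by (simp add: additive.zero[OF additive_mult_left] additive.zero[OF additive_mult_right]
          additive.zero[OF additive_linear_extension] D_zero)
  next
    case (add a b)
    have "?L (a + b) = ?L a + ?L b"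
      using add.hyps
      by (simp add: additive.add[OF additive_mult_left] D_add group_algebra_mult_closed
          group_algebra_single_closed sum.distrib)
    then show ?case
      by (simp add: add.IH additive.add[OF additive_mult_right]
          additive.add[OF additive_linear_extension])
  next
    case (single x c)
    let ?h = "\<lambda>h. D (Poly_Mapping.single h 1) \<otimes>\<^bsub>group_algebra G\<^esub>
      Poly_Mapping.single (\<tau> (inv h)) 1 \<otimes>\<^bsub>group_algebra G\<^esub> Poly_Mapping.single (\<tau> x) c"
    have term_eq: "D (Poly_Mapping.single x c \<otimes>\<^bsub>group_algebra G\<^esub> Poly_Mapping.single g 1)
        \<otimes>\<^bsub>group_algebra G\<^esub> Poly_Mapping.single (\<tau> (inv g)) 1 = ?h (x \<otimes> g)"
      if g: "g \<in> carrier G" for g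
    proof -
      have "inv (x \<otimes> g) \<otimes> x = inv g"
        using single g by (simp add: inv_mult_group m_assoc)
      then have \<tau>_eq: "\<tau> (inv (x \<otimes> g)) \<otimes> \<tau> x = \<tau> (inv g)"
        using \<tau> single g by (metis hom_mult inv_closed m_closed)
      have "D (Poly_Mapping.single (x \<otimes> g) c) =
          c \<odot>\<^bsub>group_algebra G\<^esub> D (Poly_Mapping.single (x \<otimes> g) 1)"
        using D_smult[of "Poly_Mapping.single (x \<otimes> g) 1" c] single g
        by (simp add: group_algebra_single_closed smult_single_group_algebra)
      then have "D (Poly_Mapping.single x c \<otimes>\<^bsub>group_algebra G\<^esub> Poly_Mapping.single g 1)
          \<otimes>\<^bsub>group_algebra G\<^esub> Poly_Mapping.single (\<tau> (inv g)) 1 =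
          D (Poly_Mapping.single (x \<otimes> g) 1) \<otimes>\<^bsub>group_algebra G\<^esub>
            (c \<odot>\<^bsub>group_algebra G\<^esub> Poly_Mapping.single (\<tau> (inv g)) 1)"
        by (simp add: mult_single_group_algebra smult_mult_left smult_mult_right)
      also have "\<dots> = D (Poly_Mapping.single (x \<otimes> g) 1) \<otimes>\<^bsub>group_algebra G\<^esub>
          (Poly_Mapping.single (\<tau> (inv (x \<otimes> g))) 1
            \<otimes>\<^bsub>group_algebra G\<^esub> Poly_Mapping.single (\<tau> x) c)"
        by (simp add: smult_single_group_algebra mult_single_group_algebra \<tau>_eq)
      also have "\<dots> = ?h (x \<otimes> g)"
        using single g
        by (simp add: group_algebra_mult_assoc D_closed group_algebra_single_closed \<tau>_closed)
      finally show ?thesis .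
    qed
    have "?L (Poly_Mapping.single x c) = (\<Sum>g\<in>carrier G. ?h (x \<otimes> g))"
      by (rule sum.cong) (simp_all add: term_eq)
    also have "\<dots> = (\<Sum>h\<in>carrier G. ?h h)"
      using single
      by (intro sum.reindex_bij_witness[where i = "\<lambda>h. inv x \<otimes> h" and j = "\<lambda>g. x \<otimes> g"])
        (auto simp: m_assoc[symmetric])
    also have "\<dots> = ?q \<otimes>\<^bsub>group_algebra G\<^esub> Poly_Mapping.single (\<tau> x) c"
      by (simp add: additive.sum[OF additive_mult_left])
    finally show ?case
      by (simp add: linear_extension_single)
  qed
qed

theorem corollary5:
  fixes G (structure)
    and \<sigma> \<tau> :: "'a \<Rightarrow> 'a"
    and D :: "('a \<Rightarrow>\<^sub>0 complex) \<Rightarrow> ('a \<Rightarrow>\<^sub>0 complex)"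
  assumes "group G"
    and "finite (carrier G)"
    and "\<sigma> \<in> hom G G"
    and "\<tau> \<in> hom G G"
    and "twisted_derivation G \<sigma> \<tau> D"
  shows "inner_twisted_derivation G \<sigma> \<tau> D"
proof -
  interpret group G by fact
  define A where "A = group_algebra G"
  define n where "n = card (carrier G)"
  let ?e = "\<lambda>x. Poly_Mapping.single x (1 :: complex)"
  define q where "q = (\<Sum>g\<in>carrier G. D (?e g) \<otimes>\<^bsub>A\<^esub> ?e (\<tau> (inv g)))"
  define p where "p = inverse (of_nat n) \<odot>\<^bsub>A\<^esub> q"

  have D_lin: "linear_endomorphism G D"
    and D_mult: "\<And>a b. \<lbrakk>a \<in> carrier A; b \<in> carrier A\<rbrakk> \<Longrightarrow>
      D (a \<otimes>\<^bsub>A\<^esub> b) = D a \<otimes>\<^bsub>A\<^esub> linear_extension \<tau> b + linear_extension \<sigma> a \<otimes>\<^bsub>A\<^esub> D b"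
    using assms(5) by (auto simp: twisted_derivation_def Let_def A_def)
  have D_closed: "\<And>a. a \<in> carrier A \<Longrightarrow> D a \<in> carrier A"
    using D_lin by (auto simp: linear_endomorphism_def Let_def A_def)
  have \<tau>_closed: "\<And>x. x \<in> carrier G \<Longrightarrow> \<tau> x \<in> carrier G"
    using assms(4) by (auto simp: hom_def)
  have e_closed: "\<And>x. x \<in> carrier G \<Longrightarrow> ?e x \<in> carrier A"
    unfolding A_def by (rule group_algebra_single_closed)
  have \<sigma>_ext_closed: "\<And>a. a \<in> carrier A \<Longrightarrow> linear_extension \<sigma> a \<in> carrier A"
    unfolding A_def using assms(3) by (intro linear_extension_closed) (auto simp: hom_def)
  note mult_closed = group_algebra_mult_closed[folded A_def]
    and assoc = group_algebra_mult_assoc[folded A_def]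
  have q_closed: "q \<in> carrier A"
    unfolding q_def A_def
    by (intro group_algebra_sum_closed group_algebra_mult_closed)
      (use D_closed e_closed \<tau>_closed in \<open>auto simp: A_def\<close>)
  have p_closed: "p \<in> carrier A"
    using q_closed unfolding p_def A_def by (rule group_algebra_smult_closed)
  have n_pos: "n > 0"
    using assms(2) one_closed unfolding n_def by (auto simp: card_gt_0_iff)

  have "D a = p \<otimes>\<^bsub>A\<^esub> linear_extension \<tau> a - linear_extension \<sigma> a \<otimes>\<^bsub>A\<^esub> p" if a: "a \<in> carrier A" for a
  proof -
    have term_eq: "linear_extension \<sigma> a \<otimes>\<^bsub>A\<^esub> (D (?e g) \<otimes>\<^bsub>A\<^esub> ?e (\<tau> (inv g))) =
        D (a \<otimes>\<^bsub>A\<^esub> ?e g) \<otimes>\<^bsub>A\<^esub> ?e (\<tau> (inv g)) - D a" if g: "g \<in> carrier G" for g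
    proof -
      have "\<tau> g \<otimes> \<tau> (inv g) = \<one>"
        using g assms(4) by (metis hom_mult hom_one inv_closed is_group r_inv)
      then have cancel: "D a \<otimes>\<^bsub>A\<^esub> ?e (\<tau> g) \<otimes>\<^bsub>A\<^esub> ?e (\<tau> (inv g)) = D a"
        using a g by (simp add: assoc D_closed e_closed \<tau>_closed)
          (simp add: A_def mult_single_group_algebra group_algebra_mult_one D_closed[unfolded A_def])
      have "linear_extension \<sigma> a \<otimes>\<^bsub>A\<^esub> D (?e g) = D (a \<otimes>\<^bsub>A\<^esub> ?e g) - D a \<otimes>\<^bsub>A\<^esub> ?e (\<tau> g)"
        using D_mult[OF a e_closed[OF g]] by (simp add: linear_extension_single)
      then have "linear_extension \<sigma> a \<otimes>\<^bsub>A\<^esub> D (?e g) \<otimes>\<^bsub>A\<^esub> ?e (\<tau> (inv g)) =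
          D (a \<otimes>\<^bsub>A\<^esub> ?e g) \<otimes>\<^bsub>A\<^esub> ?e (\<tau> (inv g)) - D a"
        using cancel by (simp add: A_def additive.diff[OF additive_mult_left])
      then show ?thesis
        using a g by (simp add: assoc D_closed e_closed \<tau>_closed \<sigma>_ext_closed)
    qed
    have "linear_extension \<sigma> a \<otimes>\<^bsub>A\<^esub> q =
        (\<Sum>g\<in>carrier G. linear_extension \<sigma> a \<otimes>\<^bsub>A\<^esub> (D (?e g) \<otimes>\<^bsub>A\<^esub> ?e (\<tau> (inv g))))"
      by (simp add: q_def A_def additive.sum[OF additive_mult_right])
    also have "\<dots> = (\<Sum>g\<in>carrier G. D (a \<otimes>\<^bsub>A\<^esub> ?e g) \<otimes>\<^bsub>A\<^esub> ?e (\<tau> (inv g))) - (\<Sum>g\<in>carrier G. D a)"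
      by (simp add: term_eq sum_subtractf)
    also have "(\<Sum>g\<in>carrier G. D (a \<otimes>\<^bsub>A\<^esub> ?e g) \<otimes>\<^bsub>A\<^esub> ?e (\<tau> (inv g))) = q \<otimes>\<^bsub>A\<^esub> linear_extension \<tau> a"
      unfolding q_def A_def using D_lin assms(4) a[unfolded A_def] by (rule averaged_sum_translate)
    also have "(\<Sum>g\<in>carrier G. D a) = of_nat n \<odot>\<^bsub>A\<^esub> D a"
      by (rule poly_mapping_eqI) (simp add: A_def n_def lookup_sum)
    finally have "of_nat n \<odot>\<^bsub>A\<^esub> D a = q \<otimes>\<^bsub>A\<^esub> linear_extension \<tau> a - linear_extension \<sigma> a \<otimes>\<^bsub>A\<^esub> q"
      by simp
    then have "inverse (of_nat n) \<odot>\<^bsub>A\<^esub> (of_nat n \<odot>\<^bsub>A\<^esub> D a) =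
        p \<otimes>\<^bsub>A\<^esub> linear_extension \<tau> a - linear_extension \<sigma> a \<otimes>\<^bsub>A\<^esub> p"
      by (simp add: p_def A_def additive.diff[OF additive_smult_group_algebra]
          smult_mult_left smult_mult_right)
    moreover have "inverse (of_nat n) \<odot>\<^bsub>A\<^esub> (of_nat n \<odot>\<^bsub>A\<^esub> D a) = D a"
      using n_pos by (intro poly_mapping_eqI) (simp add: A_def)
    ultimately show ?thesis
      by simp
  qed
  moreover have "p \<otimes>\<^bsub>A\<^esub> linear_extension \<tau> a \<ominus>\<^bsub>A\<^esub> linear_extension \<sigma> a \<otimes>\<^bsub>A\<^esub> p =
      p \<otimes>\<^bsub>A\<^esub> linear_extension \<tau> a - linear_extension \<sigma> a \<otimes>\<^bsub>A\<^esub> p" if "a \<in> carrier A" for a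
    using mult_closed[OF \<sigma>_ext_closed[OF that] p_closed] unfolding A_def
    by (rule minus_group_algebra)
  ultimately show ?thesis
    unfolding inner_twisted_derivation_def Let_def A_def[symmetric]
    using p_closed by (intro bexI[of _ p]) simp_all
qed

end
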